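(* Assume the exact density $\rho$, pressure $p$ and velocity $\bm v=(v_1,v_2,v_3)^\top$ are $C^2$ functions in the computational domain $\Omega$, and that there is a constant $C>0$ with $\rho(x,y,t)>C$ and $p(x,y,t)>C$ for all $(x,y)\in\Omega$ and all $t>0$. Let $h=\max(\Delta x,\Delta y)$ and suppose the reconstructed point values are second-order accurate approximations of the exact solution: $$|\rho^{n,\mp}_{i\pm\frac12,j}-\rho(x_{i\pm\frac12},y_j,t_n)|\le\mathcal O(h^2),\quad |\rho^{n,\mp}_{i,j\pm\frac12}-\rho(x_i,y_{j\pm\frac12},t_n)|\le\mathcal O(h^2),$$ $$|\bm v^{n,\mp}_{i\pm\frac12,j}-\bm v(x_{i\pm\frac12},y_j,t_n)|\le\mathcal O(h^2),\quad |\bm v^{n,\mp}_{i,j\pm\frac12}-\bm v(x_i,y_{j\pm\frac12},t_n)|\le\mathcal O(h^2),$$ $$|p^{n,\mp}_{i\pm\frac12,j}-p(x_{i\pm\frac12},y_j,t_n)|\le\mathcal O(h^2),\quad |p^{n,\mp}_{i,j\pm\frac12}-p(x_i,y_{j\pm\frac12},t_n)|\le\mathcal O(h^2).$$ Then the point values modified by the PP limiter (with fixed parameter $q>2$, see context) are still second-order accurate: $$|\tilde\rho^{n,\mp}_{i\pm\frac12,j}-\rho(x_{i\pm\frac12},y_j,t_n)|\le\mathcal O(h^2),\quad |\tilde\rho^{n,\mp}_{i,j\pm\frac12}-\rho(x_i,y_{j\pm\frac12},t_n)|\le\mathcal O(h^2),$$ $$|\tilde{\bm v}^{n,\mp}_{i\pm\frac12,j}-\bm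 v(x_{i\pm\frac12},y_j,t_n)|\le\mathcal O(h^2),\quad |\tilde{\bm v}^{n,\mp}_{i,j\pm\frac12}-\bm v(x_i,y_{j\pm\frac12},t_n)|\le\mathcal O(h^2),$$ $$|\tilde p^{n,\mp}_{i\pm\frac12,j}-p(x_{i\pm\frac12},y_j,t_n)|\le\mathcal O(h^2),\quad |\tilde p^{n,\mp}_{i,j\pm\frac12}-p(x_i,y_{j\pm\frac12},t_n)|\le\mathcal O(h^2).$$
   Context: $\Omega\subset\mathbb R^2$ is a closed bounded rectangle partitioned into a uniform rectangular mesh with sizes $\Delta x,\Delta y$; cell $I_{ij}=(x_{i-\frac12},x_{i+\frac12})\times(y_{j-\frac12},y_{j+\frac12})$ has center $(x_i,y_j)$. $\mathcal O(h^2)$ means bounded by (constant)$\cdot h^2$ as $h\to0$ at the fixed time $t_n>0$, with a constant independent of $h$ and of the cell $(i,j)$. Constants: $\gamma>1$, a fixed small $\epsilon>0$ (e.g. $10^{-14}$), a fixed $q>2$, numerical viscosity parameters $\alpha_1,\alpha_2>0$. Given numerical cell data $\overline{\bm Q}_{ij}^n=(\overline\rho_{ij}^n,\overline{\bm m}_{ij}^n,\overline E_{ij}^n)^\top$ with $\overline\rho_{ij}^n>0$ and positive pressure, the corresponding primitive values are $\overline{\bm W}_{ij}^n=(\overline\rho_{ij}^n,\overline{\bm v}_{ij}^n,\overline p_{ij}^n)^\top$, $\overline{\bm v}_{ij}^n=\overline{\bm m}_{ij}^n/\overline\rho_{ij}^n\in\mathbb R^3$, $\overline p_{ij}^n=(\gamma-1)\left(\overline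 E_{ij}^n-\frac{|\overline{\bm m}_{ij}^n|^2}{2\overline\rho_{ij}^n}\right)>0$. Reconstruction: slopes are computed componentwise by the van Albada limiter: for a scalar component $W$ with $a=(\overline W_{ij}^n-\overline W_{i-1,j}^n)/\Delta x$, $b=(\overline W_{i+1,j}^n-\overline W_{ij}^n)/\Delta x$, $\epsilon_x=3\Delta x$, set $\delta W_{ij}^x=\frac{(b^2+\epsilon_x)a+(a^2+\epsilon_x)b}{a^2+b^2+2\epsilon_x}$; $\delta W_{ij}^y$ is defined analogously in $y$ with $\epsilon_y=3\Delta y$. Put $(\Delta\rho_{ij}^x,\Delta\bm v_{ij}^x,\Delta p_{ij}^x)^\top=\frac{\Delta x}{2}\delta\bm W_{ij}^x$, $(\Delta\rho_{ij}^y,\Delta\bm v_{ij}^y,\Delta p_{ij}^y)^\top=\frac{\Delta y}{2}\delta\bm W_{ij}^y$. The reconstructed point values $(\rho,\bm v,p)^{n,\mp}$ are $\bm W^{n,\mp}_{i\pm\frac12,j}=\overline{\bm W}_{ij}^n\pm\Delta\bm W_{ij}^x$ and $\bm W^{n,\mp}_{i,j\pm\frac12}=\overline{\bm W}_{ij}^n\pm\Delta\bm W_{ij}^y$, where $\Delta\bm W^\star_{ij}=(\Delta\rho^\star_{ij},\Delta\bm v^\star_{ij},\Delta p^\star_{ij})^\top$. PP limiter: put $C_x=\frac{\alpha_1\Delta y}{\alpha_1\Delta y+\alpha_2\Delta x}$, $C_y=\frac{\alpha_2\Delta x}{\alpha_1\Delta y+\alpha_2\Delta x}$. For $\star\in\{x,y\}$: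 $\alpha^\star=\min\left(\frac{\overline\rho_{ij}^n}{|\Delta\rho_{ij}^\star|(1+\epsilon)},1\right)$ if $\Delta\rho_{ij}^\star\ne0$, else $1$; $\kappa^\star=\min\left(\frac{\overline p_{ij}^n}{|\Delta p_{ij}^\star|(1+\epsilon)},1\right)$ if $\Delta p_{ij}^\star\neq0$, else $1$. If $|\Delta\bm v_{ij}^x|+|\Delta\bm v_{ij}^y|\ne0$, $$\beta=\min\left(\sqrt{\frac{(q-2)^2\,\overline\rho_{ij}^n\,\overline p_{ij}^n}{(\gamma-1)\left(2\left|C_x\alpha^x\Delta\rho_{ij}^x\Delta\bm v_{ij}^x+C_y\alpha^y\Delta\rho_{ij}^y\Delta\bm v_{ij}^y\right|^2+(q-2)(\overline\rho_{ij}^n)^2\left(C_x|\Delta\bm v_{ij}^x|^2+C_y|\Delta\bm v_{ij}^y|^2\right)\right)}},\,1\right),$$ else $\beta=1$. The modified values are $(\tilde\rho,\tilde{\bm v},\tilde p)^{n,\mp}_{i\pm\frac12,j}=(\overline\rho_{ij}^n\pm\alpha^x\Delta\rho_{ij}^x,\ \overline{\bm v}_{ij}^n\pm\beta\Delta\bm v_{ij}^x,\ \overline p_{ij}^n\pm\kappa^x\Delta p_{ij}^x)$ and $(\tilde\rho,\tilde{\bm v},\tilde p)^{n,\mp}_{i,j\pm\frac12}=(\overline\rho_{ij}^n\pm\alpha^y\Delta\rho_{ij}^y,\ \overline{\bm v}_{ij}^n\pm\beta\Delta\bm v_{ij}^y,\ \overline p_{ij}^n\pm\kappa^y\Delta p_{ij}^y)$.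 *)

theory Defs
  imports "HOL-Analysis.Analysis"
begin

section \<open>Twice continuously differentiable functions\<close>

text \<open>The derivatives are taken within \<open>S\<close>, so that on a closed rectangle they are one-sided at
  the boundary and the first and second derivatives are continuous up to the boundary.\<close>

definition C2_on :: "(real \<times> real) set \<Rightarrow> (real \<times> real \<Rightarrow> 'b::real_normed_vector) \<Rightarrow> bool" where
  "C2_on S f \<longleftrightarrow>
     (\<exists>f' :: real \<times> real \<Rightarrow> (real \<times> real) \<Rightarrow>\<^sub>L 'b.
      \<exists>f'' :: real \<times> real \<Rightarrow> (real \<times> real) \<Rightarrow>\<^sub>L ((real \<times> real) \<Rightarrow>\<^sub>L 'b).
        (\<forall>z\<in>S. (f has_derivative blinfun_apply (f' z)) (at z within S)) \<and>
        (\<forall>z\<in>S. (f' has_derivative blinfun_apply (f'' z)) (at z within S)) \<and>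
        continuous_on S f'')"

section \<open>States and uniform rectangular meshes\<close>

text \<open>A conservative state is \<open>(\<rho>, m, E)\<close>, a primitive state is \<open>(\<rho>, v, p)\<close>.\<close>

type_synonym state = "real \<times> (real ^ 3) \<times> real"

definition pressure :: "real \<Rightarrow> state \<Rightarrow> real" where
  "pressure \<gamma> = (\<lambda>(\<rho>, m, E). (\<gamma> - 1) * (E - (norm m)\<^sup>2 / (2 * \<rho>)))"

definition primitive :: "real \<Rightarrow> state \<Rightarrow> state" where
  "primitive \<gamma> = (\<lambda>(\<rho>, m, E). (\<rho>, m /\<^sub>R \<rho>, pressure \<gamma> (\<rho>, m, E)))"

definition admissible :: "real \<Rightarrow> state \<Rightarrow> bool" where
  "admissible \<gamma> U \<longleftrightarrow> fst U > 0 \<and> pressure \<gamma> U > 0"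

text \<open>An interval \<open>[a, b]\<close> is divided into \<open>N\<close> cells, numbered \<open>1, \<dots>, N\<close>; the indices \<open>0\<close> and
  \<open>N + 1\<close> belong to the ghost cells that the slopes of the boundary cells refer to.\<close>

definition mesh_step :: "real \<Rightarrow> real \<Rightarrow> nat \<Rightarrow> real" where
  "mesh_step a b N = (b - a) / real N"

definition cell_center :: "real \<Rightarrow> real \<Rightarrow> nat \<Rightarrow> int \<Rightarrow> real" where
  "cell_center a b N i = a + (real_of_int i - 1/2) * mesh_step a b N"

definition mesh_cells :: "nat \<Rightarrow> nat \<Rightarrow> (int \<times> int) set" where
  "mesh_cells Nx Ny = {1..int Nx} \<times> {1..int Ny}"

definition stencil_cells :: "nat \<Rightarrow> nat \<Rightarrow> (int \<times> int) set" where
  "stencil_cells Nx Ny = {0..int Nx + 1} \<times> {1..int Ny} \<union> {1..int Nx} \<times> {0..int Ny + 1}"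

section \<open>Reconstruction\<close>

text \<open>Each cell has four faces, given by a direction \<open>d\<close> and a sign \<open>s \<in> {1, -1}\<close>. For example,
  the value of cell \<open>(i, j)\<close> at direction \<open>X_dir\<close> and sign \<open>1\<close> is the left trace
  \<open>W\<^sup>-\<close> at \<open>(x\<^bsub>i+1/2\<^esub>, y\<^bsub>j\<^esub>)\<close>, and at sign \<open>-1\<close> it is the right trace
  \<open>W\<^sup>+\<close> at \<open>(x\<^bsub>i-1/2\<^esub>, y\<^bsub>j\<^esub>)\<close>.\<close>

datatype direction = X_dir | Y_dir

definition face_point ::
  "real \<Rightarrow> real \<Rightarrow> real \<Rightarrow> real \<Rightarrow> nat \<Rightarrow> nat \<Rightarrow> direction \<Rightarrow> real \<Rightarrow> int \<Rightarrow> int \<Rightarrow> real \<times> real" where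
  "face_point xl xr yl yr Nx Ny d s i j =
     (case d of
        X_dir \<Rightarrow> (cell_center xl xr Nx i + s * mesh_step xl xr Nx / 2, cell_center yl yr Ny j)
      | Y_dir \<Rightarrow> (cell_center xl xr Nx i, cell_center yl yr Ny j + s * mesh_step yl yr Ny / 2))"

definition van_albada :: "real \<Rightarrow> real \<Rightarrow> real \<Rightarrow> real" where
  "van_albada e a b = ((b\<^sup>2 + e) * a + (a\<^sup>2 + e) * b) / (a\<^sup>2 + b\<^sup>2 + 2 * e)"

definition van_albada_state :: "real \<Rightarrow> state \<Rightarrow> state \<Rightarrow> state" where
  "van_albada_state e = (\<lambda>(a\<rho>, av, ap) (b\<rho>, bv, bp).
     (van_albada e a\<rho> b\<rho>, (\<chi> k. van_albada e (av $ k) (bv $ k)), van_albada e ap bp))"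

text \<open>Half the mesh size \<open>\<delta>\<close> times the limited slope; \<open>Wl\<close>, \<open>W\<close>, \<open>Wr\<close> are three consecutive
  cell values.\<close>

definition half_increment :: "real \<Rightarrow> state \<Rightarrow> state \<Rightarrow> state \<Rightarrow> state" where
  "half_increment \<delta> Wl W Wr =
     (\<delta> / 2) *\<^sub>R van_albada_state (3 * \<delta>) ((W - Wl) /\<^sub>R \<delta>) ((Wr - W) /\<^sub>R \<delta>)"

definition increment ::
  "real \<Rightarrow> real \<Rightarrow> (int \<Rightarrow> int \<Rightarrow> state) \<Rightarrow> direction \<Rightarrow> int \<Rightarrow> int \<Rightarrow> state" where
  "increment \<Delta>x \<Delta>y W d i j =
     (case d of
        X_dir \<Rightarrow> half_increment \<Delta>x (W (i - 1) j) (W i j) (W (i + 1) j)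
      | Y_dir \<Rightarrow> half_increment \<Delta>y (W i (j - 1)) (W i j) (W i (j + 1)))"

definition reconstructed ::
  "real \<Rightarrow> real \<Rightarrow> (int \<Rightarrow> int \<Rightarrow> state) \<Rightarrow> direction \<Rightarrow> real \<Rightarrow> int \<Rightarrow> int \<Rightarrow> state" where
  "reconstructed \<Delta>x \<Delta>y W d s i j = W i j + s *\<^sub>R increment \<Delta>x \<Delta>y W d i j"

section \<open>The positivity-preserving limiter\<close>

text \<open>This is \<open>\<alpha>\<^sup>\<star>\<close> when applied to the density and \<open>\<kappa>\<^sup>\<star>\<close> when applied to the pressure.\<close>

definition scalar_factor :: "real \<Rightarrow> real \<Rightarrow> real \<Rightarrow> real" where
  "scalar_factor \<epsilon> u \<Delta>u = (if \<Delta>u \<noteq> 0 then min (u / (\<bar>\<Delta>u\<bar> * (1 + \<epsilon>))) 1 else 1)"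

definition velocity_factor ::
  "real \<Rightarrow> real \<Rightarrow> real \<Rightarrow> real \<Rightarrow> real \<Rightarrow> real \<Rightarrow> real \<Rightarrow> real \<Rightarrow>
   real \<Rightarrow> real \<Rightarrow> real ^ 3 \<Rightarrow> real ^ 3 \<Rightarrow> real" where
  "velocity_factor \<gamma> q Cx Cy \<rho> p \<alpha>x \<alpha>y \<Delta>\<rho>x \<Delta>\<rho>y \<Delta>vx \<Delta>vy =
     (if norm \<Delta>vx + norm \<Delta>vy \<noteq> 0 then
        min (sqrt ((q - 2)\<^sup>2 * \<rho> * p /
                   ((\<gamma> - 1) *
                    (2 * (norm ((Cx * \<alpha>x * \<Delta>\<rho>x) *\<^sub>R \<Delta>vx + (Cy * \<alpha>y * \<Delta>\<rho>y) *\<^sub>R \<Delta>vy))\<^sup>2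
                     + (q - 2) * \<rho>\<^sup>2 * (Cx * (norm \<Delta>vx)\<^sup>2 + Cy * (norm \<Delta>vy)\<^sup>2)))))
            1
      else 1)"

definition pp_limited ::
  "real \<Rightarrow> real \<Rightarrow> real \<Rightarrow> real \<Rightarrow> real \<Rightarrow> real \<Rightarrow> real \<Rightarrow>
   (int \<Rightarrow> int \<Rightarrow> state) \<Rightarrow> direction \<Rightarrow> real \<Rightarrow> int \<Rightarrow> int \<Rightarrow> state" where
  "pp_limited \<gamma> \<epsilon> q \<alpha>\<^sub>1 \<alpha>\<^sub>2 \<Delta>x \<Delta>y W d s i j =
     (let Cx = \<alpha>\<^sub>1 * \<Delta>y / (\<alpha>\<^sub>1 * \<Delta>y + \<alpha>\<^sub>2 * \<Delta>x);
          Cy = \<alpha>\<^sub>2 * \<Delta>x / (\<alpha>\<^sub>1 * \<Delta>y + \<alpha>\<^sub>2 * \<Delta>x);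
          (\<rho>, v, p) = W i j;
          (\<Delta>\<rho>x, \<Delta>vx, \<Delta>px) = increment \<Delta>x \<Delta>y W X_dir i j;
          (\<Delta>\<rho>y, \<Delta>vy, \<Delta>py) = increment \<Delta>x \<Delta>y W Y_dir i j;
          \<alpha>x = scalar_factor \<epsilon> \<rho> \<Delta>\<rho>x;
          \<alpha>y = scalar_factor \<epsilon> \<rho> \<Delta>\<rho>y;
          \<kappa>x = scalar_factor \<epsilon> p \<Delta>px;
          \<kappa>y = scalar_factor \<epsilon> p \<Delta>py;
          \<beta> = velocity_factor \<gamma> q Cx Cy \<rho> p \<alpha>x \<alpha>y \<Delta>\<rho>x \<Delta>\<rho>y \<Delta>vx \<Delta>vy
      in case d of
           X_dir \<Rightarrow> (\<rho> + s * (\<alpha>x * \<Delta>\<rho>x), v + s *\<^sub>R (\<beta> *\<^sub>R \<Delta>vx), p + s * (\<kappa>x * \<Delta>px))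
         | Y_dir \<Rightarrow> (\<rho> + s * (\<alpha>y * \<Delta>\<rho>y), v + s *\<^sub>R (\<beta> *\<^sub>R \<Delta>vy), p + s * (\<kappa>y * \<Delta>py)))"

section \<open>Uniform order of accuracy\<close>

text \<open>The filter \<open>F\<close> on mesh indices \<open>m\<close> expresses the refinement of the mesh. The constant \<open>K\<close>
  does not depend on the mesh or on the cell \<open>c \<in> A m\<close>.\<close>

definition uniform_bigo ::
  "'m filter \<Rightarrow> ('m \<Rightarrow> 'c set) \<Rightarrow> ('m \<Rightarrow> 'c \<Rightarrow> real) \<Rightarrow> ('m \<Rightarrow> real) \<Rightarrow> bool" where
  "uniform_bigo F A e g \<longleftrightarrow> (\<exists>K>0. \<forall>\<^sub>F m in F. \<forall>c\<in>A m. \<bar>e m c\<bar> \<le> K * \<bar>g m\<bar>)"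

text \<open>\<open>W m d s i j\<close> is the primitive point value of cell \<open>(i, j)\<close> of mesh \<open>m\<close> at its face
  \<open>(d, s)\<close>. It is compared with the exact fields \<open>\<rho>\<close>, \<open>v\<close>, \<open>p\<close> at a fixed time.\<close>

definition second_order_accurate ::
  "'m filter \<Rightarrow> real \<Rightarrow> real \<Rightarrow> real \<Rightarrow> real \<Rightarrow> ('m \<Rightarrow> nat) \<Rightarrow> ('m \<Rightarrow> nat) \<Rightarrow>
   (real \<times> real \<Rightarrow> real) \<Rightarrow> (real \<times> real \<Rightarrow> real ^ 3) \<Rightarrow> (real \<times> real \<Rightarrow> real) \<Rightarrow>
   ('m \<Rightarrow> direction \<Rightarrow> real \<Rightarrow> int \<Rightarrow> int \<Rightarrow> state) \<Rightarrow> bool" where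
  "second_order_accurate F xl xr yl yr Nx Ny \<rho> v p W \<longleftrightarrow>
     (let A = (\<lambda>m. mesh_cells (Nx m) (Ny m));
          z = (\<lambda>m. face_point xl xr yl yr (Nx m) (Ny m));
          h = (\<lambda>m. max (mesh_step xl xr (Nx m)) (mesh_step yl yr (Ny m)))
      in \<forall>d. \<forall>s\<in>{1, -1}.
           uniform_bigo F A (\<lambda>m (i, j). \<bar>fst (W m d s i j) - \<rho> (z m d s i j)\<bar>) (\<lambda>m. (h m)\<^sup>2) \<and>
           uniform_bigo F A (\<lambda>m (i, j). norm (fst (snd (W m d s i j)) - v (z m d s i j))) (\<lambda>m. (h m)\<^sup>2) \<and>
           uniform_bigo F A (\<lambda>m (i, j). \<bar>snd (snd (W m d s i j)) - p (z m d s i j)\<bar>) (\<lambda>m. (h m)\<^sup>2))"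

end

theory Submission
  imports Defs
begin

text \<open>The two traces of a cell on opposite faces are \<open>W \<plusminus> \<Delta>W\<close>. Since both are close to
  the exact solution, which is uniformly continuous on the compact rectangle, \<open>\<Delta>W\<close> tends
  to \<open>0\<close> and \<open>W\<close> stays away from vacuum, uniformly in the cell. Hence on fine meshes all the
  limiting factors are equal to \<open>1\<close> and the limiter leaves the reconstruction unchanged.\<close>

section \<open>When the limiting factors equal 1\<close>

lemma scalar_factor_eq_1:
  assumes "\<epsilon> > 0" and "(1 + \<epsilon>) * \<bar>\<Delta>u\<bar> \<le> u"
  shows "scalar_factor \<epsilon> u \<Delta>u = 1"
proof (cases "\<Delta>u = 0")
  case False
  then have "(1 + \<epsilon>) * \<bar>\<Delta>u\<bar> > 0"
    using assms(1) by simp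
  then have "1 \<le> u / ((1 + \<epsilon>) * \<bar>\<Delta>u\<bar>)"
    using assms(2) by (simp only: le_divide_eq_1_pos)
  then show ?thesis
    by (simp add: scalar_factor_def mult.commute)
qed (simp add: scalar_factor_def)

text \<open>The weights \<open>Cx\<close> and \<open>Cy\<close> are convex, so the combined vector
  in the denominator has norm at most \<rho> * \<eta>, and the weighted sum of squared velocity
  increments is at most \<eta> squared. Hypothesis \<open>\<eta>\<close> is what these two bounds
  require for the radicand to be at least 1.\<close>

lemma velocity_factor_eq_1:
  fixes \<Delta>vx \<Delta>vy :: "real ^ 3"
  assumes "\<gamma> > 1" and "q > 2" and C: "Cx > 0" "Cy > 0" "Cx + Cy = 1" and "\<rho> > 0"
    and \<Delta>\<rho>: "\<bar>\<Delta>\<rho>x\<bar> \<le> \<rho>" "\<bar>\<Delta>\<rho>y\<bar> \<le> \<rho>"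
    and \<Delta>v: "norm \<Delta>vx \<le> \<eta>" "norm \<Delta>vy \<le> \<eta>"
    and \<eta>: "(\<gamma> - 1) * q * \<rho> * \<eta>\<^sup>2 \<le> (q - 2)\<^sup>2 * p"
  shows "velocity_factor \<gamma> q Cx Cy \<rho> p 1 1 \<Delta>\<rho>x \<Delta>\<rho>y \<Delta>vx \<Delta>vy = 1"
proof (cases "norm \<Delta>vx + norm \<Delta>vy = 0")
  case True
  then show ?thesis by (simp add: velocity_factor_def)
next
  case False
  \<comment> \<open>\<open>T\<close> is the bracket in the denominator of the radicand, with both
    density factors already equal to 1.\<close>
  define T where "T = 2 * (norm ((Cx * \<Delta>\<rho>x) *\<^sub>R \<Delta>vx + (Cy * \<Delta>\<rho>y) *\<^sub>R \<Delta>vy))\<^sup>2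
    + (q - 2) * \<rho>\<^sup>2 * (Cx * (norm \<Delta>vx)\<^sup>2 + Cy * (norm \<Delta>vy)\<^sup>2)"
  have "\<eta> \<ge> 0"
    using \<Delta>v(1) norm_ge_zero order_trans by blast
  \<comment> \<open>At least one velocity increment is nonzero. Strict positivity matters because
    division by zero yields 0, which would make the factor 0 instead of 1.\<close>
  have "0 < Cx * (norm \<Delta>vx)\<^sup>2 + Cy * (norm \<Delta>vy)\<^sup>2"
    using False C by (cases "\<Delta>vx = 0") (auto intro: add_pos_nonneg)
  then have "T > 0"
    using \<open>q > 2\<close> \<open>\<rho> > 0\<close> by (simp add: T_def add_nonneg_pos)
  have *: "norm ((c * r) *\<^sub>R w) \<le> c * (\<rho> * \<eta>)"
    if "c > 0" "\<bar>r\<bar> \<le> \<rho>" "norm w \<le> \<eta>" for c r and w :: "real ^ 3"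
    using that \<open>\<rho> > 0\<close> by (simp add: abs_mult mult.assoc mult_left_mono mult_mono)
  have "norm ((Cx * \<Delta>\<rho>x) *\<^sub>R \<Delta>vx + (Cy * \<Delta>\<rho>y) *\<^sub>R \<Delta>vy) \<le> Cx * (\<rho> * \<eta>) + Cy * (\<rho> * \<eta>)"
    using C \<Delta>\<rho> \<Delta>v by (intro norm_triangle_mono *)
  also have "\<dots> = \<rho> * \<eta>"
    using C(3) by (metis distrib_right mult_1)
  finally have "(norm ((Cx * \<Delta>\<rho>x) *\<^sub>R \<Delta>vx + (Cy * \<Delta>\<rho>y) *\<^sub>R \<Delta>vy))\<^sup>2 \<le> (\<rho> * \<eta>)\<^sup>2"
    by (rule power_mono) simp
  moreover have "Cx * (norm \<Delta>vx)\<^sup>2 + Cy * (norm \<Delta>vy)\<^sup>2 \<le> \<eta>\<^sup>2"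
    by (rule convex_bound_le) (use C \<Delta>v in \<open>auto intro: power_mono\<close>)
  then have "(q - 2) * \<rho>\<^sup>2 * (Cx * (norm \<Delta>vx)\<^sup>2 + Cy * (norm \<Delta>vy)\<^sup>2) \<le> (q - 2) * \<rho>\<^sup>2 * \<eta>\<^sup>2"
    using \<open>q > 2\<close> by (intro mult_left_mono) auto
  \<comment> \<open>The two contributions have coefficients 2 and q - 2, which add up to q.\<close>
  ultimately have "T \<le> q * \<rho>\<^sup>2 * \<eta>\<^sup>2"
    by (simp add: T_def power_mult_distrib algebra_simps)
  then have "(\<gamma> - 1) * T \<le> \<rho> * ((\<gamma> - 1) * q * \<rho> * \<eta>\<^sup>2)"
    using mult_left_mono[of T _ "\<gamma> - 1"] \<open>\<gamma> > 1\<close> by (simp add: power2_eq_square ac_simps)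
  also have "\<dots> \<le> \<rho> * ((q - 2)\<^sup>2 * p)"
    using \<eta> \<open>\<rho> > 0\<close> by (intro mult_left_mono) auto
  finally have "1 \<le> (q - 2)\<^sup>2 * \<rho> * p / ((\<gamma> - 1) * T)"
    using \<open>T > 0\<close> \<open>\<gamma> > 1\<close> by (simp add: ac_simps)
  then show ?thesis
    using False by (simp add: velocity_factor_def T_def)
qed

text \<open>The density and pressure factors are settled first, since the density factors enter the
  formula for the velocity factor. The bound on the density increments serves twice: it makes their
  own factors 1, and it gives the weaker bound by the cell density that the velocity factor
  needs.\<close>

lemma pp_limited_eq_reconstructed:
  fixes W :: "int \<Rightarrow> int \<Rightarrow> state"
  assumes "\<gamma> > 1" and "\<epsilon> > 0" and "q > 2" and "\<alpha>\<^sub>1 > 0" and "\<alpha>\<^sub>2 > 0" and "\<Delta>x > 0" and "\<Delta>y > 0"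
    and "fst (W i j) > 0"
    and \<Delta>\<rho>: "\<And>d. (1 + \<epsilon>) * \<bar>fst (increment \<Delta>x \<Delta>y W d i j)\<bar> \<le> fst (W i j)"
    and \<Delta>p: "\<And>d. (1 + \<epsilon>) * \<bar>snd (snd (increment \<Delta>x \<Delta>y W d i j))\<bar> \<le> snd (snd (W i j))"
    and \<Delta>v: "\<And>d. norm (fst (snd (increment \<Delta>x \<Delta>y W d i j))) \<le> \<eta>"
    and \<eta>: "(\<gamma> - 1) * q * fst (W i j) * \<eta>\<^sup>2 \<le> (q - 2)\<^sup>2 * snd (snd (W i j))"
  shows "pp_limited \<gamma> \<epsilon> q \<alpha>\<^sub>1 \<alpha>\<^sub>2 \<Delta>x \<Delta>y W d s i j = reconstructed \<Delta>x \<Delta>y W d s i j"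
proof -
  obtain \<rho> v p where W: "W i j = (\<rho>, v, p)" by (metis prod_cases3)
  obtain \<Delta>\<rho>x \<Delta>vx \<Delta>px where X: "increment \<Delta>x \<Delta>y W X_dir i j = (\<Delta>\<rho>x, \<Delta>vx, \<Delta>px)"
    by (metis prod_cases3)
  obtain \<Delta>\<rho>y \<Delta>vy \<Delta>py where Y: "increment \<Delta>x \<Delta>y W Y_dir i j = (\<Delta>\<rho>y, \<Delta>vy, \<Delta>py)"
    by (metis prod_cases3)
  have s: "scalar_factor \<epsilon> \<rho> \<Delta>\<rho>x = 1" "scalar_factor \<epsilon> \<rho> \<Delta>\<rho>y = 1"
      "scalar_factor \<epsilon> p \<Delta>px = 1" "scalar_factor \<epsilon> p \<Delta>py = 1"
    using \<Delta>\<rho>[of X_dir] \<Delta>\<rho>[of Y_dir] \<Delta>p[of X_dir] \<Delta>p[of Y_dir] \<open>\<epsilon> > 0\<close>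
    by (simp_all add: W X Y scalar_factor_eq_1)
  have le: "\<bar>r\<bar> \<le> \<rho>" if "(1 + \<epsilon>) * \<bar>r\<bar> \<le> \<rho>" for r
    using that mult_right_mono[of 1 "1 + \<epsilon>" "\<bar>r\<bar>"] \<open>\<epsilon> > 0\<close> by linarith
  have pos: "\<alpha>\<^sub>1 * \<Delta>y > 0" "\<alpha>\<^sub>2 * \<Delta>x > 0"
    using assms by auto
  have \<beta>: "velocity_factor \<gamma> q (\<alpha>\<^sub>1 * \<Delta>y / (\<alpha>\<^sub>1 * \<Delta>y + \<alpha>\<^sub>2 * \<Delta>x)) (\<alpha>\<^sub>2 * \<Delta>x / (\<alpha>\<^sub>1 * \<Delta>y + \<alpha>\<^sub>2 * \<Delta>x))
      \<rho> p 1 1 \<Delta>\<rho>x \<Delta>\<rho>y \<Delta>vx \<Delta>vy = 1"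
  proof (rule velocity_factor_eq_1)
    show "\<bar>\<Delta>\<rho>x\<bar> \<le> \<rho>" "\<bar>\<Delta>\<rho>y\<bar> \<le> \<rho>"
      using \<Delta>\<rho>[of X_dir] \<Delta>\<rho>[of Y_dir] by (simp_all add: W X Y le)
    show "norm \<Delta>vx \<le> \<eta>" "norm \<Delta>vy \<le> \<eta>"
      using \<Delta>v[of X_dir] \<Delta>v[of Y_dir] by (simp_all add: X Y)
    show "\<alpha>\<^sub>1 * \<Delta>y / (\<alpha>\<^sub>1 * \<Delta>y + \<alpha>\<^sub>2 * \<Delta>x) + \<alpha>\<^sub>2 * \<Delta>x / (\<alpha>\<^sub>1 * \<Delta>y + \<alpha>\<^sub>2 * \<Delta>x) = 1"
      using pos by (simp flip: add_divide_distrib)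
  qed (use assms W in \<open>auto intro!: divide_pos_pos add_pos_pos\<close>)
  show ?thesis
    by (cases d) (simp_all add: pp_limited_def reconstructed_def W X Y s \<beta>)
qed

section \<open>Continuity of the exact fields and geometry of the mesh\<close>

lemma C2_on_imp_continuous_on: "C2_on S f \<Longrightarrow> continuous_on S f"
  unfolding C2_on_def by (elim exE conjE, rule has_derivative_continuous_on) blast

lemma mesh_step_pos: "a < b \<Longrightarrow> N \<ge> 1 \<Longrightarrow> mesh_step a b N > 0"
  by (simp add: mesh_step_def)

text \<open>In units of the mesh step, the point lies at distance i - 1/2 + r from \<open>a\<close>,
  a number between 0 and \<open>N\<close>. The offset r = 0 gives the cell center, and r = 1/2 or r
  = -1/2 gives the two ends of the cell.\<close>

lemma cell_center_offset_mem:
  assumes "a < b" and "N \<ge> 1" and "i \<in> {1..int N}" and "\<bar>r\<bar> \<le> 1/2"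
  shows "cell_center a b N i + r * mesh_step a b N \<in> {a..b}"
proof -
  have st: "mesh_step a b N > 0"
    using assms mesh_step_pos by blast
  have eq: "cell_center a b N i + r * mesh_step a b N = a + (real_of_int i - 1/2 + r) * mesh_step a b N"
    by (simp add: cell_center_def algebra_simps)
  have i: "1 \<le> real_of_int i" "real_of_int i \<le> real N"
    using assms(3) by auto
  have "(real_of_int i - 1/2 + r) * mesh_step a b N \<le> real N * mesh_step a b N"
    using assms(4) i st by (intro mult_right_mono) auto
  also have "\<dots> = b - a"
    using \<open>N \<ge> 1\<close> by (simp add: mesh_step_def)
  finally show ?thesis
    using assms(4) i st by (auto simp: eq)
qed

lemma face_point_mem:
  assumes "xl < xr" "yl < yr" "Nx \<ge> 1" "Ny \<ge> 1" "(i, j) \<in> mesh_cells Nx Ny" "s \<in> {1, -1}"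
  shows "face_point xl xr yl yr Nx Ny d s i j \<in> {xl..xr} \<times> {yl..yr}"
  using cell_center_offset_mem[of xl xr Nx i "s/2"] cell_center_offset_mem[of xl xr Nx i 0]
    cell_center_offset_mem[of yl yr Ny j "s/2"] cell_center_offset_mem[of yl yr Ny j 0] assms
  by (cases d) (auto simp: face_point_def mesh_cells_def)

lemma dist_opposite_face_points:
  assumes "xl < xr" "yl < yr" "Nx \<ge> 1" "Ny \<ge> 1"
  shows "dist (face_point xl xr yl yr Nx Ny d 1 i j) (face_point xl xr yl yr Nx Ny d (-1) i j)
    \<le> max (mesh_step xl xr Nx) (mesh_step yl yr Ny)"
  using mesh_step_pos[of xl xr Nx] mesh_step_pos[of yl yr Ny] assms
  by (cases d) (auto simp: face_point_def dist_Pair_Pair dist_real_def)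

section \<open>Uniform smallness on fine meshes\<close>

text \<open>Trades the rate for a fixed threshold: the constant is common to all cells, so a
  vanishing \<open>g\<close> pushes the error below any \<eta> > 0 on all cells at once.\<close>

lemma uniform_bigo_eventually_le:
  assumes "uniform_bigo F A e g" and "(g \<longlongrightarrow> 0) F" and "\<eta> > 0"
  shows "\<forall>\<^sub>F m in F. \<forall>c\<in>A m. \<bar>e m c\<bar> \<le> \<eta>"
proof -
  obtain K where K: "\<forall>\<^sub>F m in F. \<forall>c\<in>A m. \<bar>e m c\<bar> \<le> K * \<bar>g m\<bar>"
    using assms(1) by (auto simp: uniform_bigo_def)
  have "((\<lambda>m. K * \<bar>g m\<bar>) \<longlongrightarrow> K * \<bar>0\<bar>) F"
    by (intro tendsto_intros assms)
  then have "\<forall>\<^sub>F m in F. K * \<bar>g m\<bar> < \<eta>"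
    by (rule order_tendstoD) (use \<open>\<eta> > 0\<close> in simp)
  with K show ?thesis
    by eventually_elim force
qed

text \<open>Lets an accuracy estimate pass from the reconstructed to the limited values once the two
  agree on fine meshes.\<close>

lemma uniform_bigo_cong:
  assumes "\<forall>\<^sub>F m in F. \<forall>c\<in>A m. e m c = e' m c"
  shows "uniform_bigo F A e g \<longleftrightarrow> uniform_bigo F A e' g"
proof -
  have "(\<forall>\<^sub>F m in F. \<forall>c\<in>A m. \<bar>e m c\<bar> \<le> K * \<bar>g m\<bar>) \<longleftrightarrow>
      (\<forall>\<^sub>F m in F. \<forall>c\<in>A m. \<bar>e' m c\<bar> \<le> K * \<bar>g m\<bar>)" for K
    by (rule eventually_cong[OF assms]) auto
  then show ?thesis
    by (simp add: uniform_bigo_def)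
qed

text \<open>The errors at two opposite faces control \<open>W + D\<close> and \<open>W - D\<close>;
  half the sum and half the difference recover \<open>W\<close> and \<open>D\<close>. The exact
  values at the two faces differ little by uniform continuity, as the faces are at most
  \<open>h\<close> apart. The value type is a general normed space so that density, velocity and
  pressure are all covered.\<close>

lemma central_value_and_increment_eventually_le:
  fixes f :: "'a::metric_space \<Rightarrow> 'b::real_normed_vector"
    and W D :: "'m \<Rightarrow> 'c \<Rightarrow> 'b"
  assumes S: "compact S" "continuous_on S f"
    and z: "\<And>m c. c \<in> A m \<Longrightarrow> z\<^sub>1 m c \<in> S \<and> z\<^sub>2 m c \<in> S \<and> dist (z\<^sub>1 m c) (z\<^sub>2 m c) \<le> h m"
    and h: "(h \<longlongrightarrow> 0) F"
    and e\<^sub>1: "uniform_bigo F A (\<lambda>m c. norm (W m c + D m c - f (z\<^sub>1 m c))) (\<lambda>m. (h m)\<^sup>2)"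
    and e\<^sub>2: "uniform_bigo F A (\<lambda>m c. norm (W m c - D m c - f (z\<^sub>2 m c))) (\<lambda>m. (h m)\<^sup>2)"
    and "\<eta> > 0"
  shows "\<forall>\<^sub>F m in F. \<forall>c\<in>A m. norm (W m c - f (z\<^sub>1 m c)) \<le> \<eta> \<and> norm (D m c) \<le> \<eta>"
proof -
  have h2: "((\<lambda>m. (h m)\<^sup>2) \<longlongrightarrow> 0) F"
    using tendsto_power[OF h, of 2] by simp
  obtain \<delta> where "\<delta> > 0" and \<delta>: "\<And>x y. x \<in> S \<Longrightarrow> y \<in> S \<Longrightarrow> dist x y < \<delta> \<Longrightarrow> dist (f x) (f y) < \<eta> / 2"
    using compact_uniformly_continuous[OF S(2,1)] \<open>\<eta> > 0\<close>
    by (metis half_gt_zero uniformly_continuous_onE dist_commute)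
  have "\<forall>\<^sub>F m in F. h m < \<delta>"
    using h \<open>\<delta> > 0\<close> by (rule order_tendstoD)
  then show ?thesis
    using uniform_bigo_eventually_le[OF e\<^sub>1 h2 half_gt_zero[OF \<open>\<eta> > 0\<close>]]
      uniform_bigo_eventually_le[OF e\<^sub>2 h2 half_gt_zero[OF \<open>\<eta> > 0\<close>]]
  proof (eventually_elim, intro ballI conjI)
    fix m c
    assume "h m < \<delta>" and c: "c \<in> A m"
      and "\<forall>c\<in>A m. \<bar>norm (W m c + D m c - f (z\<^sub>1 m c))\<bar> \<le> \<eta> / 2"
      and "\<forall>c\<in>A m. \<bar>norm (W m c - D m c - f (z\<^sub>2 m c))\<bar> \<le> \<eta> / 2"
    then have *: "norm (W m c + D m c - f (z\<^sub>1 m c)) \<le> \<eta> / 2" "norm (W m c - D m c - f (z\<^sub>2 m c)) \<le> \<eta> / 2"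
        "norm (f (z\<^sub>1 m c) - f (z\<^sub>2 m c)) \<le> \<eta> / 2"
      using \<delta>[of "z\<^sub>1 m c" "z\<^sub>2 m c"] z[OF c] by (auto simp flip: dist_norm)
    let ?a = "W m c + D m c - f (z\<^sub>1 m c)" and ?b = "W m c - D m c - f (z\<^sub>2 m c)"
      and ?g = "f (z\<^sub>1 m c) - f (z\<^sub>2 m c)"
    \<comment> \<open>Three terms of size at most \<eta>/2 bound twice the wanted norm, which leaves
      it below 3\<eta>/4. The same count applies to \<open>D\<close> below.\<close>
    have "2 * norm (W m c - f (z\<^sub>1 m c)) = norm (?a + ?b - ?g)"
      using norm_scaleR[of 2 "W m c - f (z\<^sub>1 m c)"] by (simp add: scaleR_2 algebra_simps)
    then show "norm (W m c - f (z\<^sub>1 m c)) \<le> \<eta>"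
      using norm_triangle_ineq4[of "?a + ?b" ?g] norm_triangle_ineq[of ?a ?b] * \<open>\<eta> > 0\<close> by linarith
    have "2 * norm (D m c) = norm (?a - ?b + ?g)"
      using norm_scaleR[of 2 "D m c"] by (simp add: scaleR_2 algebra_simps)
    then show "norm (D m c) \<le> \<eta>"
      using norm_triangle_ineq[of "?a - ?b" ?g] norm_triangle_ineq4[of ?a ?b] * \<open>\<eta> > 0\<close> by linarith
  qed
qed

section \<open>Second-order accuracy of the limited values\<close>

theorem theorem3p8:
  fixes xl xr yl yr :: real
    and \<rho> p :: "real \<times> real \<Rightarrow> real \<Rightarrow> real"
    and v :: "real \<times> real \<Rightarrow> real \<Rightarrow> real ^ 3"
    and \<gamma> \<epsilon> q \<alpha>\<^sub>1 \<alpha>\<^sub>2 C t\<^sub>n :: real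
    and F :: "'m filter"
    and Nx Ny :: "'m \<Rightarrow> nat"
    and Q :: "'m \<Rightarrow> int \<Rightarrow> int \<Rightarrow> state"
  assumes "xl < xr" and "yl < yr"
    and "\<gamma> > 1" and "\<epsilon> > 0" and "q > 2" and "\<alpha>\<^sub>1 > 0" and "\<alpha>\<^sub>2 > 0"
    and "t\<^sub>n > 0"
    and "\<And>t. t > 0 \<Longrightarrow> C2_on ({xl..xr} \<times> {yl..yr}) (\<lambda>z. \<rho> z t)"
    and "\<And>t. t > 0 \<Longrightarrow> C2_on ({xl..xr} \<times> {yl..yr}) (\<lambda>z. v z t)"
    and "\<And>t. t > 0 \<Longrightarrow> C2_on ({xl..xr} \<times> {yl..yr}) (\<lambda>z. p z t)"
    and "C > 0"
    and "\<And>z t. z \<in> {xl..xr} \<times> {yl..yr} \<Longrightarrow> t > 0 \<Longrightarrow> \<rho> z t > C \<and> p z t > C"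
    and "\<And>m. Nx m \<ge> 1" and "\<And>m. Ny m \<ge> 1"
    and "((\<lambda>m. max (mesh_step xl xr (Nx m)) (mesh_step yl yr (Ny m))) \<longlongrightarrow> 0) F"
    and "\<And>m i j. (i, j) \<in> stencil_cells (Nx m) (Ny m) \<Longrightarrow> admissible \<gamma> (Q m i j)"
    and "second_order_accurate F xl xr yl yr Nx Ny
           (\<lambda>z. \<rho> z t\<^sub>n) (\<lambda>z. v z t\<^sub>n) (\<lambda>z. p z t\<^sub>n)
           (\<lambda>m. reconstructed (mesh_step xl xr (Nx m)) (mesh_step yl yr (Ny m))
                  (\<lambda>i j. primitive \<gamma> (Q m i j)))"
  shows "second_order_accurate F xl xr yl yr Nx Ny
           (\<lambda>z. \<rho> z t\<^sub>n) (\<lambda>z. v z t\<^sub>n) (\<lambda>z. p z t\<^sub>n)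
           (\<lambda>m. pp_limited \<gamma> \<epsilon> q \<alpha>\<^sub>1 \<alpha>\<^sub>2 (mesh_step xl xr (Nx m)) (mesh_step yl yr (Ny m))
                  (\<lambda>i j. primitive \<gamma> (Q m i j)))"
proof -
  define S where "S = {xl..xr} \<times> {yl..yr}"
  define A where "A m = mesh_cells (Nx m) (Ny m)" for m
  define z where "z m d s = (\<lambda>(i, j). face_point xl xr yl yr (Nx m) (Ny m) d s i j)" for m d s
  define h where "h m = max (mesh_step xl xr (Nx m)) (mesh_step yl yr (Ny m))" for m
  define V where "V m i j = primitive \<gamma> (Q m i j)" for m i j
  \<comment> \<open>Cell values and increments are taken as functions of the index pair
    \<open>c\<close>, the form in which the general lemma on opposite faces applies.\<close>
  define W where "W m = (\<lambda>(i, j). V m i j)" for m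
  define D where "D m d = (\<lambda>(i, j).
    increment (mesh_step xl xr (Nx m)) (mesh_step yl yr (Ny m)) (V m) d i j)" for m d
  let ?R = "\<lambda>m. reconstructed (mesh_step xl xr (Nx m)) (mesh_step yl yr (Ny m)) (V m)"
  let ?P = "\<lambda>m. pp_limited \<gamma> \<epsilon> q \<alpha>\<^sub>1 \<alpha>\<^sub>2 (mesh_step xl xr (Nx m)) (mesh_step yl yr (Ny m)) (V m)"
  note acc = assms(18)[folded V_def, unfolded second_order_accurate_def Let_def, folded A_def h_def]
  have S: "compact S"
    unfolding S_def by (intro compact_Times compact_Icc)
  have cont: "continuous_on S (\<lambda>z. \<rho> z t\<^sub>n)" "continuous_on S (\<lambda>z. v z t\<^sub>n)" "continuous_on S (\<lambda>z. p z t\<^sub>n)"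
    using assms(8-11) by (auto simp: S_def intro: C2_on_imp_continuous_on)
  have h: "(h \<longlongrightarrow> 0) F"
    using assms(16) by (simp add: h_def[abs_def])
  have zS: "z m d s c \<in> S" if "c \<in> A m" "s \<in> {1, -1}" for m d s c
    using that assms(1,2,14,15) by (cases c) (auto simp: z_def S_def A_def intro!: face_point_mem simp del: mem_Times_iff)
  have z: "z m d 1 c \<in> S \<and> z m d (-1) c \<in> S \<and> dist (z m d 1 c) (z m d (-1) c) \<le> h m"
    if "c \<in> A m" for m d c
    using zS[OF that] dist_opposite_face_points[OF assms(1,2,14,15)] by (cases c) (auto simp: z_def h_def)
  \<comment> \<open>The smallness condition for the velocity factor contains the cell density on its
    larger-is-worse side, so an upper bound on the exact density is required as well as the lower
    bound \<open>C\<close>.\<close>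
  obtain M where M: "\<And>x. x \<in> S \<Longrightarrow> \<rho> x t\<^sub>n \<le> M"
  proof -
    have "bounded ((\<lambda>z. \<rho> z t\<^sub>n) ` S)"
      using compact_imp_bounded[OF compact_continuous_image[OF cont(1) S]] .
    then obtain B where "\<And>x. x \<in> S \<Longrightarrow> norm (\<rho> x t\<^sub>n) \<le> B"
      unfolding bounded_iff by blast
    then show thesis by (intro that[of B]) force
  qed
  have "M > 0"
    using M[of "(xl, yl)"] assms(13)[of "(xl, yl)" t\<^sub>n] assms(1,2,8,12) by (auto simp: S_def)
  \<comment> \<open>Within \<eta> of the exact solution, cell density and pressure are at least C/2,
    and (1 + \<epsilon>) * \<eta> is exactly C/2. Thus increments of size at most \<eta> satisfy the
    condition for the scalar factors.\<close>
  define \<eta> where "\<eta> = C / (2 * (1 + \<epsilon>))"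
  \<comment> \<open>\<open>\<eta>v\<close> solves the condition for the velocity factor with
    equality in the worst case, with density M + C and pressure C/2.\<close>
  define \<eta>v where "\<eta>v = sqrt ((q - 2)\<^sup>2 * (C / 2) / ((\<gamma> - 1) * q * (M + C)))"
  have \<eta>: "\<eta> > 0" "(1 + \<epsilon>) * \<eta> = C / 2" "\<eta> \<le> C / 2"
    using assms(4,12) by (auto simp: \<eta>_def field_simps)
  have pos: "(\<gamma> - 1) * q * (M + C) > 0"
    using assms(3,5,12) \<open>M > 0\<close> by auto
  have \<eta>v: "\<eta>v > 0"
    using pos assms(5,12) by (simp add: \<eta>v_def)
  have "\<eta>v\<^sup>2 = (q - 2)\<^sup>2 * (C / 2) / ((\<gamma> - 1) * q * (M + C))"
    unfolding \<eta>v_def by (rule real_sqrt_pow2) (use pos assms(12) in auto)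
  then have \<eta>v2: "(\<gamma> - 1) * q * (M + C) * \<eta>v\<^sup>2 = (q - 2)\<^sup>2 * (C / 2)"
    using pos by (metis less_irrefl nonzero_mult_div_cancel_left times_divide_eq_right)
  \<comment> \<open>The signs 1 and -1 in direction \<open>d\<close> turn the accuracy assumption
    into estimates for \<open>W + D\<close> and \<open>W - D\<close>. The two analogous facts below
    treat velocity and pressure.\<close>
  have "\<forall>\<^sub>F m in F. \<forall>c\<in>A m. norm (fst (W m c) - \<rho> (z m d 1 c) t\<^sub>n) \<le> \<eta> \<and> norm (fst (D m d c)) \<le> \<eta>" for d
    by (rule central_value_and_increment_eventually_le[OF S cont(1) z h _ _ \<eta>(1)])
      (use acc[rule_format, of 1 d] acc[rule_format, of "-1" d] in
        \<open>simp_all add: reconstructed_def W_def D_def z_def case_prod_beta'\<close>)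
  moreover have "\<forall>\<^sub>F m in F. \<forall>c\<in>A m. norm (fst (snd (W m c)) - v (z m d 1 c) t\<^sub>n) \<le> \<eta>v \<and>
      norm (fst (snd (D m d c))) \<le> \<eta>v" for d
    by (rule central_value_and_increment_eventually_le[OF S cont(2) z h _ _ \<eta>v])
      (use acc[rule_format, of 1 d] acc[rule_format, of "-1" d] in
        \<open>simp_all add: reconstructed_def W_def D_def z_def case_prod_beta'\<close>)
  moreover have "\<forall>\<^sub>F m in F. \<forall>c\<in>A m. norm (snd (snd (W m c)) - p (z m d 1 c) t\<^sub>n) \<le> \<eta> \<and>
      norm (snd (snd (D m d c))) \<le> \<eta>" for d
    by (rule central_value_and_increment_eventually_le[OF S cont(3) z h _ _ \<eta>(1)])
      (use acc[rule_format, of 1 d] acc[rule_format, of "-1" d] in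
        \<open>simp_all add: reconstructed_def W_def D_def z_def case_prod_beta'\<close>)
  \<comment> \<open>There are only two directions, so one stage of refinement serves both; a finite
    conjunction of eventual properties is eventual.\<close>
  ultimately have "\<forall>\<^sub>F m in F. \<forall>d\<in>{X_dir, Y_dir}. \<forall>c\<in>A m.
      (\<bar>fst (W m c) - \<rho> (z m d 1 c) t\<^sub>n\<bar> \<le> \<eta> \<and> \<bar>fst (D m d c)\<bar> \<le> \<eta>) \<and>
      norm (fst (snd (D m d c))) \<le> \<eta>v \<and>
      (\<bar>snd (snd (W m c)) - p (z m d 1 c) t\<^sub>n\<bar> \<le> \<eta> \<and> \<bar>snd (snd (D m d c))\<bar> \<le> \<eta>)"
    unfolding eventually_ball_finite_distrib[OF finite.insertI[OF finite.insertI[OF finite.emptyI]]]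
    by (intro ballI) (simp add: eventually_conj_iff ball_conj_distrib)
  then have eq: "\<forall>\<^sub>F m in F. \<forall>c\<in>A m. \<forall>d s. ?P m d s (fst c) (snd c) = ?R m d s (fst c) (snd c)"
  proof (eventually_elim, intro ballI allI)
    fix m c d s
    assume est: "\<forall>d\<in>{X_dir, Y_dir}. \<forall>c\<in>A m.
      (\<bar>fst (W m c) - \<rho> (z m d 1 c) t\<^sub>n\<bar> \<le> \<eta> \<and> \<bar>fst (D m d c)\<bar> \<le> \<eta>) \<and>
      norm (fst (snd (D m d c))) \<le> \<eta>v \<and>
      (\<bar>snd (snd (W m c)) - p (z m d 1 c) t\<^sub>n\<bar> \<le> \<eta> \<and> \<bar>snd (snd (D m d c))\<bar> \<le> \<eta>)"
      and c: "c \<in> A m"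
    have d: "d \<in> {X_dir, Y_dir}" for d
      by (cases d) auto
    note b = est[rule_format, OF d c]
    \<comment> \<open>The cell value is the same for both directions, so comparison with the exact
      solution at a single face suffices to bound it.\<close>
    have "z m X_dir 1 c \<in> S"
      using z[OF c] by blast
    then have "C < \<rho> (z m X_dir 1 c) t\<^sub>n" "C < p (z m X_dir 1 c) t\<^sub>n" "\<rho> (z m X_dir 1 c) t\<^sub>n \<le> M"
      using M assms(8,13) by (auto simp: S_def)
    then have w: "C / 2 \<le> fst (W m c)" "fst (W m c) \<le> M + C" "C / 2 \<le> snd (snd (W m c))"
      using b[of X_dir] \<eta>(3) assms(12) by (auto simp: abs_le_iff)
    have le: "(1 + \<epsilon>) * r \<le> C / 2" if "r \<le> \<eta>" for r
      using mult_left_mono[OF that, of "1 + \<epsilon>"] \<eta>(2) assms(4) by simp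
    have "(\<gamma> - 1) * q * fst (W m c) * \<eta>v\<^sup>2 \<le> (\<gamma> - 1) * q * (M + C) * \<eta>v\<^sup>2"
      using w assms(3,5) by (intro mult_right_mono mult_left_mono) auto
    also have "\<dots> \<le> (q - 2)\<^sup>2 * snd (snd (W m c))"
      unfolding \<eta>v2 using w by (intro mult_left_mono) auto
    finally have v: "(\<gamma> - 1) * q * fst (W m c) * \<eta>v\<^sup>2 \<le> (q - 2)\<^sup>2 * snd (snd (W m c))" .
    have W: "W m c = V m (fst c) (snd c)"
      and D: "\<And>d. D m d c = increment (mesh_step xl xr (Nx m)) (mesh_step yl yr (Ny m)) (V m) d (fst c) (snd c)"
      by (simp_all add: W_def D_def case_prod_beta)
    show "?P m d s (fst c) (snd c) = ?R m d s (fst c) (snd c)"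
    proof (rule pp_limited_eq_reconstructed[where \<eta> = \<eta>v])
      show "mesh_step xl xr (Nx m) > 0" "mesh_step yl yr (Ny m) > 0"
        using assms(1,2,14,15) by (auto intro: mesh_step_pos)
    qed (use assms(3-7,12) w v b[unfolded D] order_trans[OF le w(1)] order_trans[OF le w(3)]
      in \<open>auto simp: W\<close>)
  qed
  \<comment> \<open>The error measure \<open>e\<close> is left arbitrary, so that one equivalence
    handles the three components.\<close>
  have transfer: "uniform_bigo F A (\<lambda>m (i, j). e m (?P m d s i j) i j) g \<longleftrightarrow>
      uniform_bigo F A (\<lambda>m (i, j). e m (?R m d s i j) i j) g" for e d s g
    by (rule uniform_bigo_cong) (use eq in \<open>eventually_elim, auto simp: case_prod_beta\<close>)
  show ?thesis
    unfolding second_order_accurate_def Let_def V_def[symmetric] A_def[symmetric] h_def[symmetric]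
  proof (intro allI ballI conjI, goal_cases)
    case (1 d s)
    show ?case
      using transfer[of "\<lambda>m w i j. \<bar>fst w - \<rho> (face_point xl xr yl yr (Nx m) (Ny m) d s i j) t\<^sub>n\<bar>"] acc 1 by blast
  next
    case (2 d s)
    show ?case
      using transfer[of "\<lambda>m w i j. norm (fst (snd w) - v (face_point xl xr yl yr (Nx m) (Ny m) d s i j) t\<^sub>n)"] acc 2 by blast
  next
    case (3 d s)
    show ?case
      using transfer[of "\<lambda>m w i j. \<bar>snd (snd w) - p (face_point xl xr yl yr (Nx m) (Ny m) d s i j) t\<^sub>n\<bar>"] acc 3 by blast
  qed
qed

end
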